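(* Let $n\ge 1$ and $0\le t\le n$ be integers and let $f:\{0,1\}^n\to\{0,1\}$ be a Boolean function that is either constant or balanced. For $w\in\{0,1\}^t$ define $f_w:\{0,1\}^{n-t}\to\{0,1\}$ by $f_w(u)=f(uw)$, and for $u\in\{0,1\}^{n-t}$ let $$\delta(u)=|\{w\in\{0,1\}^t: f_w(u)=0\}|-|\{w\in\{0,1\}^t: f_w(u)=1\}|.$$ Then: (1) $f$ is constant if and only if either $\delta(u)=2^t$ for all $u\in\{0,1\}^{n-t}$, or $\delta(u)=-2^t$ for all $u\in\{0,1\}^{n-t}$; (2) $f$ is balanced if and only if $\sum_{u\in\{0,1\}^{n-t}}\delta(u)=0$.
   Context: A Boolean function $f:\{0,1\}^n\to\{0,1\}$ is constant if $f\equiv 0$ or $f\equiv 1$, and balanced if $|\{x: f(x)=0\}|=|\{x: f(x)=1\}|=2^{n-1}$. For bit strings $u,w$, $uw$ denotes their concatenation; $\{0,1\}^0$ consists of the empty string. *)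

theory Defs imports Main begin

text \<open>Bits are Booleans, with \<^const>\<open>False\<close> for 0 and \<^const>\<open>True\<close> for 1. A map
  \<open>{0,1}\<^sup>n \<rightarrow> {0,1}\<close> is represented by a function on all lists, of which only the
  values on lists of length \<open>n\<close> are ever used.\<close>

definition bits :: "nat \<Rightarrow> bool list set" where
  "bits n = {x. length x = n}"

definition constant_fun :: "nat \<Rightarrow> (bool list \<Rightarrow> bool) \<Rightarrow> bool" where
  "constant_fun n f \<longleftrightarrow> (\<forall>x\<in>bits n. f x = False) \<or> (\<forall>x\<in>bits n. f x = True)"

text \<open>The exponent \<open>n - 1\<close> is truncated subtraction, so this is meant for \<open>n \<ge> 1\<close>.\<close>

definition balanced_fun :: "nat \<Rightarrow> (bool list \<Rightarrow> bool) \<Rightarrow> bool" where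
  "balanced_fun n f \<longleftrightarrow>
     card {x \<in> bits n. f x = False} = card {x \<in> bits n. f x = True} \<and>
     card {x \<in> bits n. f x = True} = 2 ^ (n - 1)"

definition subfun :: "(bool list \<Rightarrow> bool) \<Rightarrow> bool list \<Rightarrow> bool list \<Rightarrow> bool" where
  "subfun f w u = f (u @ w)"

definition \<delta> :: "nat \<Rightarrow> (bool list \<Rightarrow> bool) \<Rightarrow> bool list \<Rightarrow> int" where
  "\<delta> t f u = int (card {w \<in> bits t. subfun f w u = False})
           - int (card {w \<in> bits t. subfun f w u = True})"

end

theory Submission imports Defs begin

text \<open>For fixed \<open>u\<close>, the zeros and ones of w \<mapsto> f(uw) number 2^t together,
  so their difference \<delta>(u) reaches 2^t or -2^t exactly when one of the two values never
  occurs. Since every string of length n splits uniquely as uw, the same extreme at every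
  \<open>u\<close> means that f itself omits a value, i.e. is constant. By the same splitting,
  summing \<delta> over \<open>u\<close> gives the zeros of f minus its ones
  (\<open>sum_delta\<close>). This vanishes iff the two counts agree, and as they add up to 2^n,
  agreement makes each 2^(n-1).\<close>

lemma finite_bits [simp]: "finite (bits n)"
  and card_bits: "card (bits n) = 2 ^ n"
  using finite_lists_length_eq[of "UNIV :: bool set" n] card_lists_length_eq[of "UNIV :: bool set" n]
  by (simp_all add: bits_def)

lemma card_False_add_card_True:
  "card {x \<in> bits n. g x = False} + card {x \<in> bits n. g x = True} = 2 ^ n"
proof -
  have "{x \<in> bits n. g x = False} \<union> {x \<in> bits n. g x = True} = bits n"
    by auto
  then show ?thesis
    by (subst card_Un_disjoint [symmetric]) (auto simp: card_bits)
qed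

lemma int_card_False_add_card_True:
  "int (card {x \<in> bits n. g x = False}) + int (card {x \<in> bits n. g x = True}) = 2 ^ n"
  using arg_cong[OF card_False_add_card_True[of n g], of int] by simp

lemma delta_eq_power_iff: "\<delta> t f u = 2 ^ t \<longleftrightarrow> (\<forall>w\<in>bits t. \<not> f (u @ w))"
proof -
  have "\<delta> t f u = 2 ^ t \<longleftrightarrow> card {w \<in> bits t. subfun f w u = True} = 0"
    \<comment> \<open>With z zeros and o ones, z + o = 2^t and z - o = 2^t force o = 0, and
      conversely.\<close>
    using int_card_False_add_card_True[of t "\<lambda>w. subfun f w u"] unfolding \<delta>_def by linarith
  then show ?thesis
    by (auto simp: subfun_def)
qed

lemma delta_eq_neg_power_iff: "\<delta> t f u = - (2 ^ t) \<longleftrightarrow> (\<forall>w\<in>bits t. f (u @ w))"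
proof -
  have "\<delta> t f u = - (2 ^ t) \<longleftrightarrow> card {w \<in> bits t. subfun f w u = False} = 0"
    using int_card_False_add_card_True[of t "\<lambda>w. subfun f w u"] unfolding \<delta>_def by linarith
  then show ?thesis
    by (auto simp: subfun_def)
qed

lemma bij_betw_append_bits:
  assumes "t \<le> n"
  shows "bij_betw (\<lambda>(u, w). u @ w) (bits (n - t) \<times> bits t) (bits n)"
  \<comment> \<open>The inverse cuts a string after its first \<open>n - t\<close> bits;
    \<open>t \<le> n\<close> makes the remainder have length \<open>t\<close>.\<close>
  by (rule bij_betw_byWitness[where f' = "\<lambda>x. (take (n - t) x, drop (n - t) x)"])
    (use assms in \<open>auto simp: bits_def\<close>)

lemma ball_bits_append:
  assumes "t \<le> n"
  shows "(\<forall>u\<in>bits (n - t). \<forall>w\<in>bits t. P (u @ w)) \<longleftrightarrow> (\<forall>x\<in>bits n. P x)"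
  unfolding bij_betw_imp_surj_on[OF bij_betw_append_bits[OF assms], symmetric] by auto

text \<open>As a sum of the signs (-1)^g(x), the difference can be reindexed along concatenation.
  The identity serves at length \<open>t\<close>, for \<delta>, and at length \<open>n\<close>, for
  f.\<close>

lemma card_False_diff_card_True:
  "int (card {x \<in> bits n. g x = False}) - int (card {x \<in> bits n. g x = True})
    = (\<Sum>x\<in>bits n. if g x then - 1 else 1)"
proof -
  have "bits n \<inter> {x. g x} = {x \<in> bits n. g x = True}"
    "bits n \<inter> - {x. g x} = {x \<in> bits n. g x = False}"
    by auto
  then show ?thesis
    by (simp add: sum.If_cases)
qed

lemma sum_delta:
  assumes "t \<le> n"
  shows "(\<Sum>u\<in>bits (n - t). \<delta> t f u)
    = int (card {x \<in> bits n. f x = False}) - int (card {x \<in> bits n. f x = True})"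
proof -
  let ?s = "\<lambda>x. if f x then - 1 else (1::int)"
  have "(\<Sum>u\<in>bits (n - t). \<delta> t f u) = (\<Sum>u\<in>bits (n - t). \<Sum>w\<in>bits t. ?s (u @ w))"
    unfolding \<delta>_def card_False_diff_card_True by (simp add: subfun_def)
  \<comment> \<open>The double sum becomes a sum over pairs, with concatenation as an explicit map
    to reindex along.\<close>
  also have "\<dots> = (\<Sum>p\<in>bits (n - t) \<times> bits t. ?s (case p of (u, w) \<Rightarrow> u @ w))"
    unfolding sum.cartesian_product by (rule sum.cong) auto
  also have "\<dots> = (\<Sum>x\<in>bits n. ?s x)"
    by (rule sum.reindex_bij_betw[OF bij_betw_append_bits[OF assms]])
  finally show ?thesis
    unfolding card_False_diff_card_True .
qed

lemma balanced_fun_iff_card_eq: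
  assumes "n \<ge> 1"
  shows "balanced_fun n f \<longleftrightarrow> card {x \<in> bits n. f x = False} = card {x \<in> bits n. f x = True}"
proof -
  \<comment> \<open>This fails at n = 0, where \<open>n - 1\<close> truncates to 0. It turns equal
    counts with total 2^n into 2^(n-1) each.\<close>
  have "(2::nat) ^ n = 2 * 2 ^ (n - 1)"
    using assms by (cases n) auto
  then show ?thesis
    using card_False_add_card_True[of n f] unfolding balanced_fun_def by linarith
qed

theorem theorem2:
  fixes n t :: nat and f :: "bool list \<Rightarrow> bool"
  assumes "n \<ge> 1" and "t \<le> n"
    and "constant_fun n f \<or> balanced_fun n f"
  shows "(constant_fun n f \<longleftrightarrow>
            (\<forall>u\<in>bits (n - t). \<delta> t f u = 2 ^ t) \<or> (\<forall>u\<in>bits (n - t). \<delta> t f u = - (2 ^ t)))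
       \<and> (balanced_fun n f \<longleftrightarrow> (\<Sum>u\<in>bits (n - t). \<delta> t f u) = 0)"
proof
  show "constant_fun n f \<longleftrightarrow>
      (\<forall>u\<in>bits (n - t). \<delta> t f u = 2 ^ t) \<or> (\<forall>u\<in>bits (n - t). \<delta> t f u = - (2 ^ t))"
    \<comment> \<open>The predicates are given explicitly because \<open>P (u @ w)\<close> is not a
      higher-order pattern.\<close>
    unfolding delta_eq_power_iff delta_eq_neg_power_iff
      ball_bits_append[OF assms(2), of "\<lambda>x. \<not> f x"] ball_bits_append[OF assms(2), of f]
    by (simp add: constant_fun_def)
  show "balanced_fun n f \<longleftrightarrow> (\<Sum>u\<in>bits (n - t). \<delta> t f u) = 0"
    unfolding balanced_fun_iff_card_eq[OF assms(1)] sum_delta[OF assms(2)] by linarith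
qed

end
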